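(* Let $m>0$, $R>0$, and let $\eta,\tau\in\mathbb{R}$ satisfy $\eta^2-\tau^2=4$. Let $H_{\eta,\tau}$ be the Dirac operator with $\delta$-shell interaction on the circle $\Sigma_R=\{(x,y)\in\mathbb{R}^2\mid x^2+y^2=R^2\}$ (defined in the context). If $\tau=0$, then the discrete eigenvalues of $H_{\eta,0}$ are symmetric with respect to $z_*=0$, meaning that $$z\in\sigma_{\mathrm{disc}}(H_{\eta,0})\quad\iff\quad -z\in\sigma_{\mathrm{disc}}(H_{\eta,0}).$$
   Context: $\sigma_0$ is the $2\times2$ identity matrix and $\sigma_1=\begin{pmatrix}0&1\\1&0\end{pmatrix}$, $\sigma_2=\begin{pmatrix}0&-i\\i&0\end{pmatrix}$, $\sigma_3=\begin{pmatrix}1&0\\0&-1\end{pmatrix}$ are the Pauli matrices; for a vector $v=(v_1,v_2)$ write $v\cdot\boldsymbol{\sigma}=v_1\sigma_1+v_2\sigma_2$, and $\boldsymbol\sigma\cdot\nabla=\sigma_1\partial_x+\sigma_2\partial_y$. Set $\Omega_+=\{x^2+y^2<R^2\}$, $\Omega_-=\{x^2+y^2>R^2\}$, and let $\boldsymbol n=(x,y)/R$ be the unit normal to $\Sigma_R$ pointing outwards of $\Omega_+$. Define $H(\boldsymbol\sigma,\Omega_\pm)=\{f\in L^2(\Omega_\pm;\mathbb{C}^2)\mid(\boldsymbol\sigma\cdot\nabla)f\in L^2(\Omega_\pm;\mathbb{C}^2)\}$; functions in this space admit Dirichlet traces $\mathcal{T}^D_\pm f\in H^{-1/2}(\Sigma_R;\mathbb{C}^2)$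 (extending the usual trace by continuity). The self-adjoint operator $H_{\eta,\tau}$ on $L^2(\mathbb{R}^2;\mathbb{C}^2)$ has domain the set of $\psi=\psi_+\oplus\psi_-\in H(\boldsymbol\sigma,\Omega_+)\oplus H(\boldsymbol\sigma,\Omega_-)$ such that $$-i(\boldsymbol n\cdot\boldsymbol\sigma)(\mathcal{T}^D_+\psi_+-\mathcal{T}^D_-\psi_-)=\tfrac12(\eta\sigma_0+\tau\sigma_3)(\mathcal{T}^D_+\psi_++\mathcal{T}^D_-\psi_-),$$ and acts as $H_{\eta,\tau}\psi=(-i\boldsymbol\sigma\cdot\nabla+m\sigma_3)\psi_+\oplus(-i\boldsymbol\sigma\cdot\nabla+m\sigma_3)\psi_-$. Here $z_*=-\frac{\tau}{\eta}m$, which equals $0$ when $\tau=0$. $\sigma_{\mathrm{disc}}$ denotes the set of isolated eigenvalues of finite multiplicity. *)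

theory Defs
  imports "HOL-Analysis.Analysis"
begin

section \<open>Pauli matrices\<close>

definition sigma0 :: "complex^2^2" where
  "sigma0 = mat 1"

definition sigma1 :: "complex^2^2" where
  "sigma1 = vector [vector [0, 1], vector [1, 0]]"

definition sigma2 :: "complex^2^2" where
  "sigma2 = vector [vector [0, - \<i>], vector [\<i>, 0]]"

definition sigma3 :: "complex^2^2" where
  "sigma3 = vector [vector [1, 0], vector [0, - 1]]"


section \<open>Smooth functions and square-integrable spinors\<close>

definition partial :: "2 \<Rightarrow> (real^2 \<Rightarrow> 'b::real_normed_vector) \<Rightarrow> real^2 \<Rightarrow> 'b" where
  "partial j f x = frechet_derivative f (at x) (axis j 1)"

primrec Ck :: "nat \<Rightarrow> (real^2 \<Rightarrow> 'b::real_normed_vector) \<Rightarrow> bool" where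
  "Ck 0 f \<longleftrightarrow> continuous_on UNIV f"
| "Ck (Suc k) f \<longleftrightarrow> (\<forall>x. f differentiable (at x)) \<and> (\<forall>j. Ck k (partial j f))"

definition test_function :: "(real^2) set \<Rightarrow> (real^2 \<Rightarrow> 'b::real_normed_vector) \<Rightarrow> bool" where
  "test_function \<Omega> \<phi> \<longleftrightarrow> (\<forall>k. Ck k \<phi>) \<and>
     compact (closure {x. \<phi> x \<noteq> 0}) \<and> closure {x. \<phi> x \<noteq> 0} \<subseteq> \<Omega>"

text \<open>Elements of the \<open>L\<^sup>2\<close> spaces are represented by functions on the whole plane, of which
  only the values almost everywhere on \<open>\<Omega>\<close> matter.  Squared norms take values in
  \<^typ>\<open>ennreal\<close>, so that no junk value arises when they are infinite.\<close>

definition L2_sqnorm :: "(real^2) set \<Rightarrow> (real^2 \<Rightarrow> complex^2) \<Rightarrow> ennreal" where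
  "L2_sqnorm \<Omega> f = (\<integral>\<^sup>+x\<in>\<Omega>. ennreal ((norm (f x))\<^sup>2) \<partial>lborel)"

definition L2 :: "(real^2) set \<Rightarrow> (real^2 \<Rightarrow> complex^2) set" where
  "L2 \<Omega> = {f. set_borel_measurable lborel \<Omega> f \<and> L2_sqnorm \<Omega> f < \<infinity>}"


section \<open>The space \<open>H(\<sigma>, \<Omega>)\<close>\<close>

definition sigma_grad :: "(real^2 \<Rightarrow> complex^2) \<Rightarrow> real^2 \<Rightarrow> complex^2" where
  "sigma_grad f x = sigma1 *v partial 1 f x + sigma2 *v partial 2 f x"

text \<open>\<open>h \<in> L\<^sup>2(\<Omega>)\<close> is the distribution \<open>(\<sigma> \<cdot> \<nabla>) f\<close> on \<open>\<Omega>\<close>.  By linearity, real-valued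
  test functions suffice.\<close>

definition weak_sigma_grad ::
    "(real^2) set \<Rightarrow> (real^2 \<Rightarrow> complex^2) \<Rightarrow> (real^2 \<Rightarrow> complex^2) \<Rightarrow> bool" where
  "weak_sigma_grad \<Omega> f h \<longleftrightarrow> f \<in> L2 \<Omega> \<and> h \<in> L2 \<Omega> \<and>
     (\<forall>\<phi> :: real^2 \<Rightarrow> real. test_function \<Omega> \<phi> \<longrightarrow>
        (LINT x:\<Omega>|lborel. \<phi> x *\<^sub>R h x) =
        - (LINT x:\<Omega>|lborel. partial 1 \<phi> x *\<^sub>R (sigma1 *v f x) + partial 2 \<phi> x *\<^sub>R (sigma2 *v f x)))"

definition H_sigma :: "(real^2) set \<Rightarrow> (real^2 \<Rightarrow> complex^2) set" where
  "H_sigma \<Omega> = {f. \<exists>h. weak_sigma_grad \<Omega> f h}"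


section \<open>The space \<open>H\<^sup>-\<^sup>1\<^sup>/\<^sup>2\<close> on the circle\<close>

definition circle :: "real \<Rightarrow> real \<Rightarrow> real^2" where
  "circle R t = vector [R * cos t, R * sin t]"

definition fourier_coeff :: "(real \<Rightarrow> complex) \<Rightarrow> int \<Rightarrow> complex" where
  "fourier_coeff u k = integral {0..2 * pi} (\<lambda>t. u t * cis (- (of_int k * t))) / (2 * pi)"

text \<open>A \<open>\<complex>\<^sup>2\<close>-valued distribution on the circle of radius \<open>R\<close> is represented by its sequence of
  Fourier coefficients in the angle; \<open>H\<^sup>-\<^sup>1\<^sup>/\<^sup>2\<close> carries the weights \<open>(1 + k\<^sup>2)\<^sup>-\<^sup>1\<^sup>/\<^sup>2\<close>.\<close>

definition circle_restrict :: "real \<Rightarrow> (real^2 \<Rightarrow> complex^2) \<Rightarrow> int \<Rightarrow> complex^2" where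
  "circle_restrict R f k = (\<chi> a. fourier_coeff (\<lambda>t. f (circle R t) $ a) k)"

definition Hmhalf_sqnorm :: "(int \<Rightarrow> complex^2) \<Rightarrow> ennreal" where
  "Hmhalf_sqnorm g = (\<Sum>\<^sub>\<infinity>k. ennreal ((1 + (real_of_int k)\<^sup>2) powr (- 1 / 2) * (norm (g k))\<^sup>2))"

definition Hmhalf :: "(int \<Rightarrow> complex^2) set" where
  "Hmhalf = {g. Hmhalf_sqnorm g < \<infinity>}"

text \<open>The product of a distribution with the function \<open>a\<close> of the angle is the convolution of the
  Fourier coefficients.  It is used for the components of the normal only, where \<open>a\<close> is a
  trigonometric polynomial and the sum is finite.\<close>

definition circle_mult :: "(real \<Rightarrow> complex) \<Rightarrow> (int \<Rightarrow> complex^2) \<Rightarrow> int \<Rightarrow> complex^2" where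
  "circle_mult a g k = (\<Sum>\<^sub>\<infinity>j. fourier_coeff a j *s g (k - j))"

definition unit_normal :: "real \<Rightarrow> real^2 \<Rightarrow> real^2" where
  "unit_normal R x = (1 / R) *\<^sub>R x"

definition normal_sigma :: "real \<Rightarrow> (int \<Rightarrow> complex^2) \<Rightarrow> int \<Rightarrow> complex^2" where
  "normal_sigma R g k =
     sigma1 *v circle_mult (\<lambda>t. of_real (unit_normal R (circle R t) $ 1)) g k +
     sigma2 *v circle_mult (\<lambda>t. of_real (unit_normal R (circle R t) $ 2)) g k"


section \<open>Dirichlet traces\<close>

text \<open>The extension by continuity of the restriction of smooth functions to the circle: \<open>g\<close> is the
  trace of \<open>f \<in> H(\<sigma>, \<Omega>)\<close> if some \<open>\<Phi> n \<in> C\<^sub>c\<^sup>\<infinity>(\<real>\<^sup>2; \<complex>\<^sup>2)\<close> converge to \<open>f\<close> in the graph norm of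
  \<open>H(\<sigma>, \<Omega>)\<close> while their restrictions to the circle converge to \<open>g\<close> in \<open>H\<^sup>-\<^sup>1\<^sup>/\<^sup>2\<close>.  For the two
  domains below these functions are dense in \<open>H(\<sigma>, \<Omega>)\<close> and the restriction is bounded, so the
  trace exists and is unique.\<close>

definition dirichlet_trace ::
    "(real^2) set \<Rightarrow> real \<Rightarrow> (real^2 \<Rightarrow> complex^2) \<Rightarrow> (int \<Rightarrow> complex^2) \<Rightarrow> bool" where
  "dirichlet_trace \<Omega> R f g \<longleftrightarrow> g \<in> Hmhalf \<and>
     (\<exists>h \<Phi>. weak_sigma_grad \<Omega> f h \<and> (\<forall>n::nat. test_function UNIV (\<Phi> n)) \<and>
        (\<lambda>n. L2_sqnorm \<Omega> (\<lambda>x. \<Phi> n x - f x)) \<longlonglongrightarrow> 0 \<and>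
        (\<lambda>n. L2_sqnorm \<Omega> (\<lambda>x. sigma_grad (\<Phi> n) x - h x)) \<longlonglongrightarrow> 0 \<and>
        (\<lambda>n. Hmhalf_sqnorm (\<lambda>k. circle_restrict R (\<Phi> n) k - g k)) \<longlonglongrightarrow> 0)"


section \<open>The Dirac operator with a delta-shell interaction\<close>

definition Omega_plus :: "real \<Rightarrow> (real^2) set" where
  "Omega_plus R = {x. (x $ 1)\<^sup>2 + (x $ 2)\<^sup>2 < R\<^sup>2}"

definition Omega_minus :: "real \<Rightarrow> (real^2) set" where
  "Omega_minus R = {x. (x $ 1)\<^sup>2 + (x $ 2)\<^sup>2 > R\<^sup>2}"

definition shell_domain :: "real \<Rightarrow> real \<Rightarrow> real \<Rightarrow> (real^2 \<Rightarrow> complex^2) set" where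
  "shell_domain R \<eta> \<tau> = {\<psi> \<in> L2 UNIV. \<psi> \<in> H_sigma (Omega_plus R) \<and> \<psi> \<in> H_sigma (Omega_minus R) \<and>
     (\<exists>gp gm. dirichlet_trace (Omega_plus R) R \<psi> gp \<and> dirichlet_trace (Omega_minus R) R \<psi> gm \<and>
        (\<forall>k. (- \<i>) *s normal_sigma R (\<lambda>j. gp j - gm j) k =
             (1 / 2) *\<^sub>R ((\<eta> *\<^sub>R sigma0 + \<tau> *\<^sub>R sigma3) *v (gp k + gm k))))}"

text \<open>The graph of \<open>H\<^sub>\<eta>\<^sub>,\<^sub>\<tau>\<close>, saturated under equality almost everywhere.\<close>

definition dirac_shell ::
    "real \<Rightarrow> real \<Rightarrow> real \<Rightarrow> real \<Rightarrow> ((real^2 \<Rightarrow> complex^2) \<times> (real^2 \<Rightarrow> complex^2)) set" where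
  "dirac_shell m R \<eta> \<tau> = {(\<psi>, \<phi>). \<psi> \<in> shell_domain R \<eta> \<tau> \<and> \<phi> \<in> L2 UNIV \<and>
     (\<exists>h. weak_sigma_grad (Omega_plus R) \<psi> h \<and> weak_sigma_grad (Omega_minus R) \<psi> h \<and>
        (AE x in lborel. \<phi> x = (- \<i>) *s h x + (m *\<^sub>R sigma3) *v \<psi> x))}"


section \<open>Spectrum\<close>

text \<open>In this section \<open>T\<close> is the graph of a linear operator in \<open>L\<^sup>2(\<real>\<^sup>2; \<complex>\<^sup>2)\<close>, saturated under
  equality almost everywhere.  The three clauses of the resolvent set say that \<open>T - z\<close> is injective
  and surjective and that its inverse is bounded.\<close>

definition eigenspace ::
    "((real^2 \<Rightarrow> complex^2) \<times> (real^2 \<Rightarrow> complex^2)) set \<Rightarrow> complex \<Rightarrow> (real^2 \<Rightarrow> complex^2) set" where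
  "eigenspace T z = {\<psi>. (\<psi>, \<lambda>x. z *s \<psi> x) \<in> T}"

definition resolvent_set ::
    "((real^2 \<Rightarrow> complex^2) \<times> (real^2 \<Rightarrow> complex^2)) set \<Rightarrow> complex set" where
  "resolvent_set T = {z.
     (\<forall>\<psi>\<in>eigenspace T z. AE x in lborel. \<psi> x = 0) \<and>
     (\<forall>g\<in>L2 UNIV. \<exists>\<psi>. (\<psi>, \<lambda>x. z *s \<psi> x + g x) \<in> T) \<and>
     (\<exists>C::real. \<forall>g\<in>L2 UNIV. \<forall>\<psi>. (\<psi>, \<lambda>x. z *s \<psi> x + g x) \<in> T \<longrightarrow>
        L2_sqnorm UNIV \<psi> \<le> ennreal (C\<^sup>2) * L2_sqnorm UNIV g)}"

definition spectrum ::
    "((real^2 \<Rightarrow> complex^2) \<times> (real^2 \<Rightarrow> complex^2)) set \<Rightarrow> complex set" where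
  "spectrum T = - resolvent_set T"

definition is_eigenvalue ::
    "((real^2 \<Rightarrow> complex^2) \<times> (real^2 \<Rightarrow> complex^2)) set \<Rightarrow> complex \<Rightarrow> bool" where
  "is_eigenvalue T z \<longleftrightarrow> (\<exists>\<psi>\<in>eigenspace T z. \<not> (AE x in lborel. \<psi> x = 0))"

definition finite_multiplicity ::
    "((real^2 \<Rightarrow> complex^2) \<times> (real^2 \<Rightarrow> complex^2)) set \<Rightarrow> complex \<Rightarrow> bool" where
  "finite_multiplicity T z \<longleftrightarrow> (\<exists>B. finite B \<and> B \<subseteq> eigenspace T z \<and>
     (\<forall>\<psi>\<in>eigenspace T z. \<exists>c. AE x in lborel. \<psi> x = (\<Sum>b\<in>B. c b *s b x)))"

definition discrete_spectrum ::
    "((real^2 \<Rightarrow> complex^2) \<times> (real^2 \<Rightarrow> complex^2)) set \<Rightarrow> complex set" where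
  "discrete_spectrum T =
     {z. is_eigenvalue T z \<and> z isolated_in spectrum T \<and> finite_multiplicity T z}"

end

theory Submission
  imports Defs
begin

text \<open>
  The unitary involution \<open>(L \<psi>)(x, y) = \<plusminus> \<sigma>\<^sub>2 \<psi>(x, -y)\<close>, with sign \<open>-\<close> inside and \<open>+\<close> outside the
  circle, anticommutes with the operator, so its graph at \<open>z\<close> is carried to its graph at \<open>-z\<close>.
  Conjugation by \<open>\<sigma>\<^sub>2\<close> and the reflection anticommutes with \<open>-i \<sigma> \<cdot> \<nabla> + m \<sigma>\<^sub>3\<close> and with
  \<open>n \<cdot> \<sigma>\<close>.  At \<open>\<tau> = 0\<close> the coupling is critical, \<open>\<eta> = 2 s\<close> with \<open>s = \<plusminus>1\<close>, and since
  \<open>(n \<cdot> \<sigma>)\<^sup>2 = 1\<close> the transmission condition reads \<open>\<psi>\<^sub>+ = i s (n \<cdot> \<sigma>) \<psi>\<^sub>-\<close>; the sign that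
  \<open>n \<cdot> \<sigma>\<close> picks up is compensated by the sign change of \<open>\<psi>\<^sub>+\<close>.
\<close>

section \<open>Reflection of the plane\<close>

definition reflect :: "real^2 \<Rightarrow> real^2" where
  "reflect x = vector [x $ 1, - x $ 2]"

lemma reflect_nth [simp]: "reflect x $ 1 = x $ 1" "reflect x $ 2 = - x $ 2"
  by (simp_all add: reflect_def)

lemma reflect_reflect [simp]: "reflect (reflect x) = x"
  by (simp add: vec_eq_iff forall_2)

lemma bounded_linear_reflect: "bounded_linear reflect"
  by (intro linear_linear[THEN iffD2] linearI) (simp_all add: vec_eq_iff forall_2)

lemma measurable_reflect [measurable]: "reflect \<in> borel \<rightarrow>\<^sub>M borel"
  by (intro borel_measurable_continuous_onI linear_continuous_on bounded_linear_reflect)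

lemma reflect_axis [simp]:
  "reflect (axis 1 1) = axis 1 1" "reflect (axis 2 1) = - axis 2 1"
  by (simp_all add: vec_eq_iff forall_2 axis_def)

lemma reflect_in_Omega [simp]:
  "reflect x \<in> Omega_plus R \<longleftrightarrow> x \<in> Omega_plus R"
  "reflect x \<in> Omega_minus R \<longleftrightarrow> x \<in> Omega_minus R"
  by (simp_all add: Omega_plus_def Omega_minus_def)

section \<open>Invariance of Lebesgue measure and of integrals under the reflection\<close>

text \<open>The reflection is diagonal in the standard basis with entries \<open>1\<close> and
  \<open>- 1\<close>, so \<open>lborel_affine_euclidean\<close> applies with a density equal to the
  product of their absolute values, which is 1.\<close>

lemma distr_reflect: "distr lborel borel reflect = lborel"
proof -
  define c where "c = (\<lambda>j :: real^2. if j = axis 2 1 then - 1 else 1 :: real)"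
  have B: "(Basis :: (real^2) set) = {axis 1 1, axis 2 1}"
    by (auto simp: Basis_vec_def UNIV_2)
  have ne: "(axis 1 1 :: real^2) \<noteq> axis 2 1"
    by (simp add: axis_eq_axis)
  have "reflect = (\<lambda>x. 0 + (\<Sum>j\<in>Basis. (c j * (x \<bullet> j)) *\<^sub>R j))"
    unfolding B using ne
    by (simp add: fun_eq_iff c_def vec_eq_iff[of "reflect _"] forall_2 cart_eq_inner_axis[symmetric])
      (simp add: axis_def)
  moreover have "lborel = density (distr lborel borel (\<lambda>x. 0 + (\<Sum>j\<in>Basis. (c j * (x \<bullet> j)) *\<^sub>R j)))
      (\<lambda>_. (\<Prod>j\<in>Basis. \<bar>c j\<bar>))"
    by (rule lborel_affine_euclidean) (simp add: c_def)
  moreover have "(\<Prod>j\<in>Basis. \<bar>c j\<bar>) = 1"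
    by (rule prod.neutral) (simp add: c_def)
  ultimately show ?thesis
    by (simp add: density_1)
qed

lemma AE_reflect:
  assumes "AE x in lborel. P x"
  shows "AE x in lborel. P (reflect x)"
proof -
  have "AE x in distr lborel borel reflect. P x"
    using assms unfolding distr_reflect .
  then show ?thesis
    by (rule AE_distrD[rotated]) simp
qed

text \<open>The integral of an arbitrary \<open>f\<close> is a supremum over simple functions below
  it, and these are measurable, so the image measure applies to them. This gives one inequality for
  every \<open>f\<close>; used for the reflected function, it gives the reverse one.\<close>

lemma nn_integral_reflect:
  "(\<integral>\<^sup>+x. f (reflect x) \<partial>lborel) = (\<integral>\<^sup>+x. f x \<partial>lborel)"
proof -
  have le: "(\<integral>\<^sup>+x. f x \<partial>lborel) \<le> (\<integral>\<^sup>+x. f (reflect x) \<partial>lborel)" for f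
    unfolding nn_integral_def[of lborel f]
  proof (rule SUP_least)
    fix g assume "g \<in> {g. simple_function lborel g \<and> g \<le> f}"
    then have g: "simple_function lborel g" "g \<le> f" by auto
    then have [measurable]: "g \<in> borel_measurable borel"
      using borel_measurable_simple_function by fastforce
    have "integral\<^sup>S lborel g = (\<integral>\<^sup>+x. g x \<partial>distr lborel borel reflect)"
      using g by (simp add: distr_reflect nn_integral_eq_simple_integral)
    also have "\<dots> = (\<integral>\<^sup>+x. g (reflect x) \<partial>lborel)"
      by (rule nn_integral_distr) auto
    also have "\<dots> \<le> (\<integral>\<^sup>+x. f (reflect x) \<partial>lborel)"
      using g by (intro nn_integral_mono) (auto simp: le_fun_def)
    finally show "integral\<^sup>S lborel g \<le> (\<integral>\<^sup>+x. f (reflect x) \<partial>lborel)" .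
  qed
  show ?thesis
    using le[of f] le[of "\<lambda>x. f (reflect x)"] by simp
qed

text \<open>Measurable functions are covered by the image measure. For all others both integrals
  have the default value 0, since reflecting twice gives back \<open>f\<close>.\<close>

lemma lebesgue_integral_reflect:
  fixes f :: "real^2 \<Rightarrow> 'b::{banach, second_countable_topology}"
  shows "(LINT x|lborel. f (reflect x)) = (LINT x|lborel. f x)"
proof (cases "f \<in> borel_measurable borel")
  case True
  then have "(LINT x|distr lborel borel reflect. f x) = (LINT x|lborel. f (reflect x))"
    by (intro integral_distr) auto
  then show ?thesis by (simp add: distr_reflect)
next
  case False
  have "(\<lambda>x. f (reflect x)) \<notin> borel_measurable borel"
  proof
    assume "(\<lambda>x. f (reflect x)) \<in> borel_measurable borel"
    from measurable_compose[OF measurable_reflect this] False show False by simp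
  qed
  then have "\<not> integrable lborel (\<lambda>x. f (reflect x))" "\<not> integrable lborel f"
    using False borel_measurable_integrable[of lborel] by auto
  then show ?thesis
    by (simp add: not_integrable_integral_eq)
qed

section \<open>The symmetry\<close>

lemma sigma_mult_nth [simp]:
  "(sigma1 *v v) $ 1 = v $ 2" "(sigma1 *v v) $ 2 = v $ 1"
  "(sigma2 *v v) $ 1 = - \<i> * v $ 2" "(sigma2 *v v) $ 2 = \<i> * v $ 1"
  "((m *\<^sub>R sigma3) *v v) $ 1 = m *\<^sub>R v $ 1" "((m *\<^sub>R sigma3) *v v) $ 2 = - (m *\<^sub>R v $ 2)"
  by (simp_all add: sigma1_def sigma2_def sigma3_def matrix_vector_mult_def sum_2)

lemma norm_sigma2_mult [simp]: "norm (sigma2 *v v) = norm v"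
  by (simp add: norm_vec_def L2_set_def sum_2 norm_mult add.commute)

text \<open>The sign \<open>c\<close> is a parameter because it differs on the two sides of the
  circle and because the gradient of \<open>flip c f\<close> is expressed through
  \<open>flip (- c)\<close>.\<close>

definition flip :: "real \<Rightarrow> (real^2 \<Rightarrow> complex^2) \<Rightarrow> real^2 \<Rightarrow> complex^2" where
  "flip c f x = c *\<^sub>R (sigma2 *v f (reflect x))"

lemma flip_diff: "flip c (\<lambda>x. f x - g x) = (\<lambda>x. flip c f x - flip c g x)"
  by (simp add: fun_eq_iff flip_def matrix_vector_mult_diff_distrib scaleR_diff_right)

lemma bounded_linear_sigma2: "bounded_linear (\<lambda>v. c *\<^sub>R (sigma2 *v v))"
  by (intro bounded_linear_compose[OF bounded_linear_scaleR_right] matrix_vector_mul_bounded_linear)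

text \<open>Instances are the disc, its exterior and the whole plane.\<close>

locale reflection_invariant =
  fixes \<Omega> :: "(real^2) set"
  assumes invariant [simp]: "reflect x \<in> \<Omega> \<longleftrightarrow> x \<in> \<Omega>"
begin

lemma L2_sqnorm_flip:
  assumes "\<bar>c\<bar> = 1"
  shows "L2_sqnorm \<Omega> (flip c f) = L2_sqnorm \<Omega> f"
proof -
  have "L2_sqnorm \<Omega> (flip c f) =
      (\<integral>\<^sup>+x. ennreal ((norm (f (reflect x)))\<^sup>2) * indicator \<Omega> (reflect x) \<partial>lborel)"
    using assms by (auto simp: L2_sqnorm_def flip_def indicator_def intro!: nn_integral_cong)
  also have "\<dots> = L2_sqnorm \<Omega> f"
    unfolding L2_sqnorm_def by (rule nn_integral_reflect)
  finally show ?thesis .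
qed

lemma L2_flip:
  assumes "\<bar>c\<bar> = 1" "f \<in> L2 \<Omega>"
  shows "flip c f \<in> L2 \<Omega>"
proof -
  have [measurable]: "(\<lambda>x. indicator \<Omega> x *\<^sub>R f x) \<in> borel_measurable borel"
    using assms(2) by (simp add: L2_def set_borel_measurable_def)
  have [measurable]: "(\<lambda>v. c *\<^sub>R (sigma2 *v v)) \<in> borel \<rightarrow>\<^sub>M borel"
    by (intro borel_measurable_continuous_onI linear_continuous_on bounded_linear_sigma2)
  \<comment> \<open>Measurability is known only for \<open>f\<close> cut off outside
    \<open>\<Omega>\<close>; by invariance of \<open>\<Omega>\<close> the cut-off commutes with the
    reflection.\<close>
  have "(\<lambda>x. c *\<^sub>R (sigma2 *v (\<lambda>x. indicator \<Omega> x *\<^sub>R f x) (reflect x))) \<in> borel_measurable borel"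
    by measurable
  moreover have "(\<lambda>x. c *\<^sub>R (sigma2 *v (\<lambda>x. indicator \<Omega> x *\<^sub>R f x) (reflect x))) =
      (\<lambda>x. indicator \<Omega> x *\<^sub>R flip c f x)"
    by (auto simp: fun_eq_iff flip_def indicator_def)
  ultimately show ?thesis
    using assms L2_sqnorm_flip[OF assms(1), of f]
    by (simp add: L2_def set_borel_measurable_def)
qed

end

section \<open>Derivatives, test functions and weak gradients under the reflection\<close>

text \<open>Chain rule; the sign comes from \<open>reflect (axis 2 1) = - axis 2 1\<close>. The map
  \<open>A\<close> is the identity for scalar test functions and a multiple of \<open>sigma2\<close>
  for spinors.\<close>

lemma partial_reflect:
  assumes "\<And>x. f differentiable (at x)" "bounded_linear A"
  shows "(\<lambda>x. A (f (reflect x))) differentiable (at x)"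
    and "partial 1 (\<lambda>x. A (f (reflect x))) x = A (partial 1 f (reflect x))"
    and "partial 2 (\<lambda>x. A (f (reflect x))) x = - A (partial 2 f (reflect x))"
proof -
  let ?D = "frechet_derivative f (at (reflect x))"
  have D: "(f has_derivative ?D) (at (reflect x))"
    using assms(1) frechet_derivative_works by blast
  have "((\<lambda>x. f (reflect x)) has_derivative (\<lambda>v. ?D (reflect v))) (at x)"
    using has_derivative_compose[OF bounded_linear.has_derivative[OF bounded_linear_reflect has_derivative_ident] D]
    by simp
  then have *: "((\<lambda>x. A (f (reflect x))) has_derivative (\<lambda>v. A (?D (reflect v)))) (at x)"
    by (rule bounded_linear.has_derivative[OF assms(2)])
  then show "(\<lambda>x. A (f (reflect x))) differentiable (at x)"
    by (rule differentiableI)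
  have "linear ?D" "linear A"
    using D assms(2) has_derivative_linear bounded_linear.linear by auto
  then show "partial 1 (\<lambda>x. A (f (reflect x))) x = A (partial 1 f (reflect x))"
    and "partial 2 (\<lambda>x. A (f (reflect x))) x = - A (partial 2 f (reflect x))"
    unfolding partial_def frechet_derivative_at[OF *, symmetric]
    by (simp_all add: linear_neg)
qed

text \<open>The induction is over all \<open>A\<close>, because a derivative in the second direction
  replaces \<open>A\<close> by \<open>- A\<close>.\<close>

lemma Ck_reflect:
  assumes "Ck k f" "bounded_linear A"
  shows "Ck k (\<lambda>x. A (f (reflect x)))"
  using assms
proof (induction k arbitrary: f A)
  case 0
  have "continuous_on UNIV (\<lambda>x. f (reflect x))"
    by (rule continuous_on_compose2[where t = UNIV])
      (use 0 in \<open>auto intro: linear_continuous_on bounded_linear_reflect\<close>)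
  then show ?case
    using 0 bounded_linear.continuous_on by auto
next
  case (Suc k)
  then have diff: "\<And>x. f differentiable (at x)" by simp
  have "partial 1 (\<lambda>x. A (f (reflect x))) = (\<lambda>x. A (partial 1 f (reflect x)))"
    "partial 2 (\<lambda>x. A (f (reflect x))) = (\<lambda>x. - A (partial 2 f (reflect x)))"
    using partial_reflect[OF diff Suc.prems(2)] by auto
  moreover have "Ck k (\<lambda>x. A (partial 1 f (reflect x)))"
    using Suc by auto
  moreover have "Ck k (\<lambda>x. - A (partial 2 f (reflect x)))"
    using Suc.prems by (intro Suc.IH bounded_linear_minus) auto
  ultimately show ?case
    using partial_reflect(1)[OF diff Suc.prems(2)] by (simp add: forall_2)
qed

text \<open>The new function vanishes outside the reflected old support, which is compact and hence
  closed, so it also contains the closure.\<close>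

lemma test_function_reflect:
  assumes "test_function \<Omega> f" "bounded_linear A" "reflect ` \<Omega> \<subseteq> \<Omega>"
  shows "test_function \<Omega> (\<lambda>x. A (f (reflect x)))"
proof -
  let ?K = "closure {x. f x \<noteq> 0}"
  have K: "compact ?K" "?K \<subseteq> \<Omega>" and Ck: "\<And>k. Ck k f"
    using assms(1) by (auto simp: test_function_def)
  have cK: "compact (reflect ` ?K)"
    by (intro compact_continuous_image K linear_continuous_on bounded_linear_reflect)
  have "{x. A (f (reflect x)) \<noteq> 0} \<subseteq> reflect ` ?K"
  proof
    fix x assume "x \<in> {x. A (f (reflect x)) \<noteq> 0}"
    then have "f (reflect x) \<noteq> 0"
      using assms(2) by (auto simp: linear_0 bounded_linear.linear)
    then have "reflect x \<in> ?K"
      using closure_subset by fastforce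
    then show "x \<in> reflect ` ?K"
      by (metis image_eqI reflect_reflect)
  qed
  then have sub: "closure {x. A (f (reflect x)) \<noteq> 0} \<subseteq> reflect ` ?K"
    using cK closure_minimal compact_imp_closed by blast
  then have "compact (closure {x. A (f (reflect x)) \<noteq> 0})"
    using cK by (meson closed_closure closed_subset compact_closure bounded_subset compact_imp_bounded closure_subset order_trans)
  then show ?thesis
    using sub K assms(3) Ck_reflect[OF Ck assms(2)] unfolding test_function_def by blast
qed

text \<open>Both terms change sign: \<open>sigma1\<close> anticommutes with \<open>sigma2\<close>,
  while \<open>sigma2\<close> commutes with itself but its derivative is reversed by the
  reflection.\<close>

lemma sigma_grad_flip:
  assumes "\<And>x. f differentiable (at x)"
  shows "sigma_grad (flip c f) x = flip (- c) (sigma_grad f) x"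
  unfolding sigma_grad_def flip_def
  using partial_reflect(2,3)[OF assms bounded_linear_sigma2, of c x]
  by (simp add: vec_eq_iff forall_2 algebra_simps)

context reflection_invariant
begin

text \<open>The distributional form of \<open>sigma_grad_flip\<close>: the weak identity for
  \<open>f\<close> is tested with the reflected test function and transported back.\<close>

lemma weak_sigma_grad_flip:
  assumes c: "\<bar>c\<bar> = 1" and fh: "weak_sigma_grad \<Omega> f h"
  shows "weak_sigma_grad \<Omega> (flip c f) (flip (- c) h)"
  unfolding weak_sigma_grad_def
proof (intro conjI allI impI)
  show "flip c f \<in> L2 \<Omega>" "flip (- c) h \<in> L2 \<Omega>"
    using assms by (auto simp: weak_sigma_grad_def intro: L2_flip)
  fix \<phi> :: "real^2 \<Rightarrow> real" assume \<phi>: "test_function \<Omega> \<phi>"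
  let ?\<psi> = "\<lambda>x. \<phi> (reflect x)"
  let ?V = "\<lambda>v. c *\<^sub>R (sigma2 *v v)"
  \<comment> \<open>\<open>?V\<close> is its own inverse, as \<open>c * c = 1\<close> and
    \<open>sigma2\<close> squares to the identity. An invertible bounded map passes through the
    integral for every \<open>F\<close>, including those with default integral 0.\<close>
  have V: "(LINT x|lborel. ?V (F x)) = ?V (LINT x|lborel. F x)" for F :: "real^2 \<Rightarrow> complex^2"
    by (rule integral_bounded_linear'[OF bounded_linear_sigma2 bounded_linear_sigma2[of c]])
      (use c in \<open>auto simp: vec_eq_iff forall_2 abs_if split: if_splits\<close>)
  have "\<And>x. \<phi> differentiable (at x)"
    using \<phi> unfolding test_function_def by (metis Ck.simps(2))
  note D = partial_reflect(2,3)[OF this bounded_linear_ident]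
  have "test_function \<Omega> ?\<psi>"
    by (rule test_function_reflect[OF \<phi> bounded_linear_ident]) auto
  then have weak: "(LINT x:\<Omega>|lborel. ?\<psi> x *\<^sub>R h x) = - (LINT x:\<Omega>|lborel.
      partial 1 ?\<psi> x *\<^sub>R (sigma1 *v f x) + partial 2 ?\<psi> x *\<^sub>R (sigma2 *v f x))"
    using fh by (simp add: weak_sigma_grad_def)
  \<comment> \<open>Since \<open>?\<psi> (reflect x) = \<phi> x\<close>, the integrand is a function
    of \<open>reflect x\<close>, ready for the substitution.\<close>
  have "(LINT x:\<Omega>|lborel. \<phi> x *\<^sub>R flip (- c) h x) =
      (LINT x|lborel. - ?V (indicator \<Omega> (reflect x) *\<^sub>R ?\<psi> (reflect x) *\<^sub>R h (reflect x)))"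
    unfolding set_lebesgue_integral_def
    by (intro Bochner_Integration.integral_cong) (auto simp: flip_def indicator_def vec_eq_iff forall_2)
  also have "\<dots> = - ?V (LINT x:\<Omega>|lborel. ?\<psi> x *\<^sub>R h x)"
    unfolding integral_minus V set_lebesgue_integral_def
    by (subst lebesgue_integral_reflect[symmetric]) simp
  also have "\<dots> = ?V (LINT x:\<Omega>|lborel.
      partial 1 ?\<psi> x *\<^sub>R (sigma1 *v f x) + partial 2 ?\<psi> x *\<^sub>R (sigma2 *v f x))"
    unfolding weak by (simp add: vec_eq_iff forall_2)
  also have "\<dots> = (LINT x|lborel. ?V (indicator \<Omega> x *\<^sub>R
      (partial 1 ?\<psi> x *\<^sub>R (sigma1 *v f x) + partial 2 ?\<psi> x *\<^sub>R (sigma2 *v f x))))"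
    unfolding V set_lebesgue_integral_def ..
  also have "\<dots> = (LINT x|lborel. ?V (indicator \<Omega> (reflect x) *\<^sub>R
      (partial 1 ?\<psi> (reflect x) *\<^sub>R (sigma1 *v f (reflect x)) +
       partial 2 ?\<psi> (reflect x) *\<^sub>R (sigma2 *v f (reflect x)))))"
    by (rule lebesgue_integral_reflect[symmetric])
  \<comment> \<open>The minus sign arises from anticommutation in the \<open>sigma1\<close> term and
    from the reversed partial derivative in the \<open>sigma2\<close> term.\<close>
  also have "\<dots> = (LINT x|lborel. - (indicator \<Omega> x *\<^sub>R
      (partial 1 \<phi> x *\<^sub>R (sigma1 *v flip c f x) + partial 2 \<phi> x *\<^sub>R (sigma2 *v flip c f x))))"
    by (intro Bochner_Integration.integral_cong)
      (auto simp: D flip_def indicator_def vec_eq_iff forall_2 algebra_simps)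
  also have "\<dots> = - (LINT x:\<Omega>|lborel.
      partial 1 \<phi> x *\<^sub>R (sigma1 *v flip c f x) + partial 2 \<phi> x *\<^sub>R (sigma2 *v flip c f x))"
    unfolding set_lebesgue_integral_def by simp
  finally show "(LINT x:\<Omega>|lborel. \<phi> x *\<^sub>R flip (- c) h x) = - (LINT x:\<Omega>|lborel.
      partial 1 \<phi> x *\<^sub>R (sigma1 *v flip c f x) + partial 2 \<phi> x *\<^sub>R (sigma2 *v flip c f x))" .
qed

end

lemma test_function_flip:
  assumes "test_function UNIV f"
  shows "test_function UNIV (flip c f)"
  using test_function_reflect[OF assms bounded_linear_sigma2, of c] by (simp add: flip_def[abs_def])


section \<open>Fourier coefficients on the circle\<close>

text \<open>On the circle the reflection sends the angle \<open>t\<close> to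
  \<open>2 * pi - t\<close>. This maps the interval of integration onto itself and turns the
  exponential of index \<open>k\<close> into that of index \<open>- k\<close>.\<close>

lemma fourier_coeff_circle_reflect:
  fixes F :: "real^2 \<Rightarrow> complex"
  shows "fourier_coeff (\<lambda>t. F (reflect (circle R t))) k = fourier_coeff (\<lambda>t. F (circle R t)) (- k)"
proof -
  define f where "f = (\<lambda>t. F (circle R t) * cis (- (of_int (- k) * t)))"
  have refl: "reflect (circle R t) = circle R (- t + 2 * pi)" for t
    by (simp add: vec_eq_iff forall_2 circle_def)
  have cis: "cis (- (of_int k * t)) = cis (- (of_int (- k) * (- t + 2 * pi)))" for t
  proof -
    have "- (of_int (- k) * (- t + 2 * pi)) = - (of_int k * t) + 2 * pi * of_int k"
      by (simp add: algebra_simps)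
    then show ?thesis
      by (simp only: cis_mult[symmetric] cis_multiple_2pi Ints_of_int mult_1_right)
  qed
  have "integral {0..2 * pi} (\<lambda>t. F (reflect (circle R t)) * cis (- (of_int k * t))) =
      integral {0..2 * pi} (\<lambda>t. f (- t + 2 * pi))"
    unfolding refl cis f_def ..
  also have "\<dots> = integral {- (2 * pi)..0} (\<lambda>t. f (t + 2 * pi))"
    using Henstock_Kurzweil_Integration.integral_reflect_real[of "2 * pi" 0 "\<lambda>t. f (- t + 2 * pi)"]
    by (simp only: minus_minus minus_zero)
  also have "\<dots> = integral {0..2 * pi} f"
    using integral_shift_real_ivl[of 0 "2 * pi" "2 * pi" f] by (simp only: diff_self diff_0)
  finally show ?thesis
    by (simp only: fourier_coeff_def f_def)
qed

lemma fourier_coeff_lincomb: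
  assumes "continuous_on {0..2 * pi} u" "continuous_on {0..2 * pi} v"
  shows "fourier_coeff (\<lambda>t. a * u t + b * v t) k = a * fourier_coeff u k + b * fourier_coeff v k"
proof -
  have i: "(\<lambda>t. w t * cis (- (of_int k * t))) integrable_on {0..2 * pi}"
    if "continuous_on {0..2 * pi} w" for w
    using that by (intro integrable_continuous_real continuous_intros) auto
  have "integral {0..2 * pi} (\<lambda>t. (a * u t + b * v t) * cis (- (of_int k * t))) =
      integral {0..2 * pi} (\<lambda>t. a * (u t * cis (- (of_int k * t))) + b * (v t * cis (- (of_int k * t))))"
    by (simp add: algebra_simps)
  also have "\<dots> = a * integral {0..2 * pi} (\<lambda>t. u t * cis (- (of_int k * t))) +
      b * integral {0..2 * pi} (\<lambda>t. v t * cis (- (of_int k * t)))"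
    using i[OF assms(1)] i[OF assms(2)]
    by (subst integral_add) (auto intro: integrable_on_mult_right)
  finally show ?thesis
    by (simp add: fourier_coeff_def add_divide_distrib)
qed

text \<open>Orthogonality of the exponentials: for \<open>k \<noteq> n\<close> the antiderivative
  \<open>exp (c * t) / c\<close> takes equal values at both ends of the period.\<close>

lemma fourier_coeff_cis:
  "fourier_coeff (\<lambda>t. cis (of_int n * t)) k = (if k = n then 1 else 0)"
proof (cases "k = n")
  case True
  then show ?thesis
    by (simp add: fourier_coeff_def cis_mult scaleR_conv_of_real)
next
  case False
  define c where "c = \<i> * of_int (n - k)"
  have c: "c \<noteq> 0" using False by (simp add: c_def)
  have e: "cis (of_int n * t) * cis (- (of_int k * t)) = exp (c * of_real t)" for t
    by (simp add: c_def cis_mult) (simp add: cis_conv_exp algebra_simps)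
  have "((\<lambda>t. exp (c * of_real t)) has_integral
      (exp (c * of_real (2 * pi)) / c - exp (c * of_real 0) / c)) {0..2 * pi}"
  proof (rule fundamental_theorem_of_calculus)
    fix t :: real
    have "((\<lambda>z. exp (c * z) / c) has_field_derivative exp (c * of_real t)) (at (of_real t))"
      using c by (auto intro!: derivative_eq_intros)
    then show "((\<lambda>t. exp (c * of_real t) / c) has_vector_derivative exp (c * of_real t))
        (at t within {0..2 * pi})"
      by (rule has_vector_derivative_real_field)
  qed simp
  moreover have "exp (c * of_real (2 * pi)) = 1"
  proof -
    have "c * of_real (2 * pi) = \<i> * of_real (2 * pi * of_int (n - k))"
      by (simp add: c_def)
    then have "exp (c * of_real (2 * pi)) = cis (2 * pi * of_int (n - k))"
      by (simp only: cis_conv_exp)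
    also have "\<dots> = 1"
      by (rule cis_multiple_2pi) auto
    finally show ?thesis .
  qed
  ultimately have "integral {0..2 * pi} (\<lambda>t. exp (c * of_real t)) = 0"
    by (simp add: integral_unique)
  then show ?thesis
    using False by (simp add: fourier_coeff_def e)
qed

text \<open>The only possibly nonzero Fourier coefficients of the factor have index 1 and -1, so the
  convolution collapses to two terms.\<close>

lemma circle_mult_trig:
  "circle_mult (\<lambda>t. a * cis t + b * cis (- t)) g k = a *s g (k - 1) + b *s g (k + 1)"
proof -
  have cont: "continuous_on {0..2 * pi} (\<lambda>t. cis (of_int n * t))" for n
    by (intro continuous_intros)
  have "fourier_coeff (\<lambda>t. a * cis t + b * cis (- t)) j =
      (if j = 1 then a else if j = - 1 then b else 0)" for j
    using fourier_coeff_lincomb[OF cont[of 1] cont[of "- 1"], of a b j]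
    unfolding fourier_coeff_cis by auto
  then have "circle_mult (\<lambda>t. a * cis t + b * cis (- t)) g k =
      (\<Sum>\<^sub>\<infinity>j\<in>{1, - 1}. (if j = 1 then a else b) *s g (k - j))"
    unfolding circle_mult_def by (intro infsum_cong_neutral) auto
  then show ?thesis by simp
qed

text \<open>\<open>n \<cdot> \<sigma>\<close> has the off-diagonal entries \<open>cis (- t)\<close> and \<open>cis t\<close>, which shift the Fourier index.\<close>

lemma normal_sigma_nth:
  assumes "R > 0"
  shows "normal_sigma R g k $ 1 = g (k + 1) $ 2" "normal_sigma R g k $ 2 = g (k - 1) $ 1"
proof -
  have "(\<lambda>t. complex_of_real (unit_normal R (circle R t) $ 1)) = (\<lambda>t. 1 / 2 * cis t + 1 / 2 * cis (- t))"
    "(\<lambda>t. complex_of_real (unit_normal R (circle R t) $ 2)) = (\<lambda>t. (- \<i> / 2) * cis t + (\<i> / 2) * cis (- t))"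
    using assms by (auto simp: fun_eq_iff unit_normal_def circle_def complex_eq_iff)
  then have eq: "normal_sigma R g k = sigma1 *v ((1 / 2) *s g (k - 1) + (1 / 2) *s g (k + 1)) +
      sigma2 *v ((- \<i> / 2) *s g (k - 1) + (\<i> / 2) *s g (k + 1))"
    by (simp only: normal_sigma_def circle_mult_trig)
  \<comment> \<open>In each component the \<open>sigma1\<close> and \<open>sigma2\<close>
    contributions cancel at one of the two shifted indices and add up at the other.\<close>
  show "normal_sigma R g k $ 1 = g (k + 1) $ 2" "normal_sigma R g k $ 2 = g (k - 1) $ 1"
    by (simp_all add: eq algebra_simps)
qed

section \<open>Traces under the reflection\<close>

text \<open>The action of \<open>flip\<close> on Fourier coefficients of boundary values: the
  reflection reverses the index.\<close>

definition trace_flip :: "real \<Rightarrow> (int \<Rightarrow> complex^2) \<Rightarrow> int \<Rightarrow> complex^2" where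
  "trace_flip c g k = c *\<^sub>R (sigma2 *v g (- k))"

lemma trace_flip_diff: "trace_flip c (\<lambda>k. g k - h k) = (\<lambda>k. trace_flip c g k - trace_flip c h k)"
  by (simp add: fun_eq_iff trace_flip_def matrix_vector_mult_diff_distrib scaleR_diff_right)

text \<open>The weights are even in \<open>k\<close> and \<open>sigma2\<close> is unitary.\<close>

lemma Hmhalf_sqnorm_trace_flip:
  assumes "\<bar>c\<bar> = 1"
  shows "Hmhalf_sqnorm (trace_flip c g) = Hmhalf_sqnorm g"
proof -
  let ?w = "\<lambda>k. ennreal ((1 + (real_of_int k)\<^sup>2) powr (- 1 / 2) * (norm (g k))\<^sup>2)"
  have "Hmhalf_sqnorm (trace_flip c g) = (\<Sum>\<^sub>\<infinity>k. ?w (- k))"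
    using assms by (simp add: Hmhalf_sqnorm_def trace_flip_def)
  also have "\<dots> = Hmhalf_sqnorm g"
    unfolding Hmhalf_sqnorm_def
    by (rule infsum_reindex_bij_betw) (simp add: bij_uminus)
  finally show ?thesis .
qed

text \<open>Each row of \<open>sigma2\<close> has a single nonzero entry, so each component of the
  flipped function is a multiple of one reflected component, and scaling the coefficients
  suffices.\<close>

lemma circle_restrict_flip:
  assumes "continuous_on UNIV f"
  shows "circle_restrict R (flip c f) = trace_flip c (circle_restrict R f)"
proof -
  have scale: "fourier_coeff (\<lambda>t. a * u t) k = a * fourier_coeff u k" for a u k
    by (simp add: fourier_coeff_def mult.assoc integral_mult_right)
  show ?thesis
    using scale[of "of_real c * (- \<i>)"] scale[of "of_real c * \<i>"]
      fourier_coeff_circle_reflect[of "\<lambda>x. f x $ 1"] fourier_coeff_circle_reflect[of "\<lambda>x. f x $ 2"]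
    by (simp add: fun_eq_iff vec_eq_iff forall_2 circle_restrict_def trace_flip_def flip_def
      scaleR_conv_of_real[where 'a = complex] mult.assoc)
qed

text \<open>Flipping the approximating sequence gives an approximating sequence for the flipped
  function: all three error norms are unchanged, with \<open>flip (- c) h\<close> as the new weak
  gradient.\<close>

lemma (in reflection_invariant) dirichlet_trace_flip:
  assumes c: "\<bar>c\<bar> = 1" and "dirichlet_trace \<Omega> R f g"
  shows "dirichlet_trace \<Omega> R (flip c f) (trace_flip c g)"
proof -
  obtain h \<Phi> where g: "g \<in> Hmhalf" and h: "weak_sigma_grad \<Omega> f h"
    and \<Phi>: "\<And>n::nat. test_function UNIV (\<Phi> n)"
    and lim: "(\<lambda>n. L2_sqnorm \<Omega> (\<lambda>x. \<Phi> n x - f x)) \<longlonglongrightarrow> 0"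
      "(\<lambda>n. L2_sqnorm \<Omega> (\<lambda>x. sigma_grad (\<Phi> n) x - h x)) \<longlonglongrightarrow> 0"
      "(\<lambda>n. Hmhalf_sqnorm (\<lambda>k. circle_restrict R (\<Phi> n) k - g k)) \<longlonglongrightarrow> 0"
    using assms(2) unfolding dirichlet_trace_def by blast
  have Ck: "Ck k (\<Phi> n)" for k n
    using \<Phi> by (simp add: test_function_def)
  have cont: "continuous_on UNIV (\<Phi> n)" for n
    using Ck[of 0] by simp
  have diff: "\<Phi> n differentiable (at x)" for n x
    using Ck[of "Suc 0"] by simp
  have c': "\<bar>- c\<bar> = 1" using c by simp
  have "trace_flip c g \<in> Hmhalf"
    using g by (simp add: Hmhalf_def Hmhalf_sqnorm_trace_flip[OF c])
  moreover have "weak_sigma_grad \<Omega> (flip c f) (flip (- c) h)"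
    using c h by (rule weak_sigma_grad_flip)
  moreover have "test_function UNIV (flip c (\<Phi> n))" for n
    using \<Phi> by (rule test_function_flip)
  moreover have "(\<lambda>n. L2_sqnorm \<Omega> (\<lambda>x. flip c (\<Phi> n) x - flip c f x)) \<longlonglongrightarrow> 0"
    using lim(1) by (simp only: flip_diff[symmetric] L2_sqnorm_flip[OF c])
  moreover have "(\<lambda>n. L2_sqnorm \<Omega> (\<lambda>x. sigma_grad (flip c (\<Phi> n)) x - flip (- c) h x)) \<longlonglongrightarrow> 0"
    using lim(2) by (simp only: sigma_grad_flip[OF diff] flip_diff[symmetric] L2_sqnorm_flip[OF c'])
  moreover have "(\<lambda>n. Hmhalf_sqnorm (\<lambda>k. circle_restrict R (flip c (\<Phi> n)) k - trace_flip c g k)) \<longlonglongrightarrow> 0"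
    using lim(3) by (simp only: circle_restrict_flip[OF cont] trace_flip_diff[symmetric]
      Hmhalf_sqnorm_trace_flip[OF c])
  ultimately show ?thesis
    unfolding dirichlet_trace_def by (intro conjI exI allI) auto
qed

section \<open>The shell operator\<close>

text \<open>This is the symmetry \<open>L\<close>; points on the circle itself, a null set, take the
  outer sign.\<close>

definition shell_flip :: "real \<Rightarrow> (real^2 \<Rightarrow> complex^2) \<Rightarrow> real^2 \<Rightarrow> complex^2" where
  "shell_flip R f x = flip (if x \<in> Omega_plus R then - 1 else 1) f x"

lemma shell_flip_cong:
  "f (reflect x) = g (reflect x) \<Longrightarrow> shell_flip R f x = shell_flip R g x"
  by (simp add: shell_flip_def flip_def)

section \<open>Passing from each side of the circle to the whole plane\<close>

text \<open>Every part of the definition sees only values on \<open>\<Omega>\<close>. This allows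
  \<open>shell_flip\<close> to be replaced on each side of the circle by a \<open>flip\<close> of
  constant sign.\<close>

lemma weak_sigma_grad_cong:
  assumes "\<And>x. x \<in> \<Omega> \<Longrightarrow> f x = f' x" "\<And>x. x \<in> \<Omega> \<Longrightarrow> h x = h' x"
  shows "weak_sigma_grad \<Omega> f h \<longleftrightarrow> weak_sigma_grad \<Omega> f' h'"
proof -
  have i: "indicator \<Omega> x *\<^sub>R f x = indicator \<Omega> x *\<^sub>R f' x"
    "indicator \<Omega> x *\<^sub>R h x = indicator \<Omega> x *\<^sub>R h' x" for x
    using assms by (auto simp: indicator_def)
  have "L2_sqnorm \<Omega> f = L2_sqnorm \<Omega> f'" "L2_sqnorm \<Omega> h = L2_sqnorm \<Omega> h'"
    unfolding L2_sqnorm_def using assms by (auto simp: indicator_def intro!: nn_integral_cong)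
  then have "f \<in> L2 \<Omega> \<longleftrightarrow> f' \<in> L2 \<Omega>" "h \<in> L2 \<Omega> \<longleftrightarrow> h' \<in> L2 \<Omega>"
    unfolding L2_def set_borel_measurable_def i mem_Collect_eq by auto
  moreover have "(LINT x:\<Omega>|lborel. \<phi> x *\<^sub>R h x) = (LINT x:\<Omega>|lborel. \<phi> x *\<^sub>R h' x)"
    "(LINT x:\<Omega>|lborel. partial 1 \<phi> x *\<^sub>R (sigma1 *v f x) + partial 2 \<phi> x *\<^sub>R (sigma2 *v f x)) =
     (LINT x:\<Omega>|lborel. partial 1 \<phi> x *\<^sub>R (sigma1 *v f' x) + partial 2 \<phi> x *\<^sub>R (sigma2 *v f' x))"
    for \<phi> :: "real^2 \<Rightarrow> real"
    unfolding set_lebesgue_integral_def using assms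
    by (auto simp: indicator_def intro!: Bochner_Integration.integral_cong)
  ultimately show ?thesis
    unfolding weak_sigma_grad_def by simp
qed

lemma dirichlet_trace_cong:
  assumes "\<And>x. x \<in> \<Omega> \<Longrightarrow> f x = f' x"
  shows "dirichlet_trace \<Omega> R f g \<longleftrightarrow> dirichlet_trace \<Omega> R f' g"
proof -
  have "weak_sigma_grad \<Omega> f h \<longleftrightarrow> weak_sigma_grad \<Omega> f' h" for h
    using assms by (intro weak_sigma_grad_cong) auto
  moreover have "L2_sqnorm \<Omega> (\<lambda>x. \<Phi> x - f x) = L2_sqnorm \<Omega> (\<lambda>x. \<Phi> x - f' x)" for \<Phi>
    unfolding L2_sqnorm_def using assms by (auto simp: indicator_def intro!: nn_integral_cong)
  ultimately show ?thesis
    unfolding dirichlet_trace_def by simp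
qed

interpretation Omega_plus: reflection_invariant "Omega_plus R" for R
  by unfold_locales simp

interpretation Omega_minus: reflection_invariant "Omega_minus R" for R
  by unfold_locales simp

interpretation plane: reflection_invariant UNIV
  by unfold_locales simp

lemma Omega_disjoint: "x \<in> Omega_minus R \<Longrightarrow> x \<notin> Omega_plus R"
  by (simp add: Omega_plus_def Omega_minus_def)

lemma weak_sigma_grad_shell_flip:
  assumes "weak_sigma_grad (Omega_plus R) f h" "weak_sigma_grad (Omega_minus R) f h"
  shows "weak_sigma_grad (Omega_plus R) (shell_flip R f) (\<lambda>x. - shell_flip R h x)"
    "weak_sigma_grad (Omega_minus R) (shell_flip R f) (\<lambda>x. - shell_flip R h x)"
proof -
  show "weak_sigma_grad (Omega_plus R) (shell_flip R f) (\<lambda>x. - shell_flip R h x)"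
    using Omega_plus.weak_sigma_grad_flip[OF _ assms(1), of "- 1"]
    by (subst weak_sigma_grad_cong[of _ _ "flip (- 1) f" _ "flip 1 h"])
      (auto simp: shell_flip_def flip_def)
  show "weak_sigma_grad (Omega_minus R) (shell_flip R f) (\<lambda>x. - shell_flip R h x)"
    using Omega_minus.weak_sigma_grad_flip[OF _ assms(2), of 1]
    by (subst weak_sigma_grad_cong[of _ _ "flip 1 f" _ "flip (- 1) h"])
      (auto simp: shell_flip_def flip_def Omega_disjoint)
qed

lemma dirichlet_trace_shell_flip:
  "dirichlet_trace (Omega_plus R) R f g \<Longrightarrow>
    dirichlet_trace (Omega_plus R) R (shell_flip R f) (trace_flip (- 1) g)"
  "dirichlet_trace (Omega_minus R) R f g \<Longrightarrow>
    dirichlet_trace (Omega_minus R) R (shell_flip R f) (trace_flip 1 g)"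
  using Omega_plus.dirichlet_trace_flip[of "- 1" R R f g] Omega_minus.dirichlet_trace_flip[of 1 R R f g]
    dirichlet_trace_cong[of "Omega_plus R" "shell_flip R f" "flip (- 1) f"]
    dirichlet_trace_cong[of "Omega_minus R" "shell_flip R f" "flip 1 f"]
  by (auto simp: shell_flip_def Omega_disjoint)

lemma shell_flip_shell_flip [simp]: "shell_flip R (shell_flip R f) = f"
  by (auto simp: fun_eq_iff shell_flip_def flip_def vec_eq_iff forall_2)

lemma L2_sqnorm_shell_flip [simp]: "L2_sqnorm UNIV (shell_flip R f) = L2_sqnorm UNIV f"
proof -
  have "L2_sqnorm UNIV (shell_flip R f) = L2_sqnorm UNIV (flip 1 f)"
    unfolding L2_sqnorm_def by (intro nn_integral_cong) (simp add: shell_flip_def flip_def)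
  then show ?thesis by (simp add: plane.L2_sqnorm_flip)
qed

text \<open>Measurability follows by gluing two measurable functions along the open disc.\<close>

lemma L2_shell_flip:
  assumes "f \<in> L2 UNIV"
  shows "shell_flip R f \<in> L2 UNIV"
proof -
  have "flip c f \<in> borel_measurable borel" if "\<bar>c\<bar> = 1" for c
    using plane.L2_flip[OF that assms] by (simp add: L2_def set_borel_measurable_def)
  moreover have "open (Omega_plus R)"
    unfolding Omega_plus_def by (intro open_Collect_less continuous_intros)
  ultimately have "(\<lambda>x. if x \<in> Omega_plus R then flip (- 1) f x else flip 1 f x) \<in> borel_measurable borel"
    by (intro measurable_If_set) auto
  moreover have "(\<lambda>x. if x \<in> Omega_plus R then flip (- 1) f x else flip 1 f x) = shell_flip R f"
    by (auto simp: fun_eq_iff shell_flip_def)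
  ultimately show ?thesis
    using assms by (simp add: L2_def set_borel_measurable_def)
qed

section \<open>Invariance of the transmission condition and of the operator\<close>

text \<open>The opposite signs inside and outside exchange the jump and the sum of the two traces.
  The condition equates the rotated jump with \<open>s\<close> times the sum, and since
  \<open>s\<close> is its own inverse it survives the exchange.\<close>

lemma boundary_condition_flip:
  assumes R: "R > 0" and \<eta>: "\<eta>\<^sup>2 = 4"
    and bc: "\<And>k. (- \<i>) *s normal_sigma R (\<lambda>j. gp j - gm j) k =
      (1 / 2) *\<^sub>R ((\<eta> *\<^sub>R sigma0 + 0 *\<^sub>R sigma3) *v (gp k + gm k))"
  defines "gp' \<equiv> trace_flip (- 1) gp" and "gm' \<equiv> trace_flip 1 gm"
  shows "(- \<i>) *s normal_sigma R (\<lambda>j. gp' j - gm' j) k =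
      (1 / 2) *\<^sub>R ((\<eta> *\<^sub>R sigma0 + 0 *\<^sub>R sigma3) *v (gp' k + gm' k))"
proof -
  define s where "s = \<eta> / 2"
  have "s\<^sup>2 = 1" using \<eta> by (simp add: s_def power_divide)
  then have s: "s = 1 \<or> s = - 1" by (simp add: power2_eq_1_iff)
  have M: "(1 / 2) *\<^sub>R ((\<eta> *\<^sub>R sigma0 + 0 *\<^sub>R sigma3) *v v) = s *\<^sub>R v" for v :: "complex^2"
    by (simp add: s_def sigma0_def vec_eq_iff forall_2 matrix_vector_mult_def sum_2 mat_def
      scaleR_conv_of_real[where 'a = complex])
  have 1: "- \<i> * (gp (k + 1) $ 2 - gm (k + 1) $ 2) = s *\<^sub>R (gp k $ 1 + gm k $ 1)"
    and 2: "- \<i> * (gp (k - 1) $ 1 - gm (k - 1) $ 1) = s *\<^sub>R (gp k $ 2 + gm k $ 2)" for k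
    using arg_cong[OF bc[of k], of "\<lambda>v. v $ 1"] arg_cong[OF bc[of k], of "\<lambda>v. v $ 2"]
    unfolding M by (simp_all add: normal_sigma_nth[OF R])
  \<comment> \<open>The indices \<open>- 1 - k\<close> and \<open>1 - k\<close> are the negatives of
    \<open>k + 1\<close> and \<open>k - 1\<close>, the shifted indices that occur in the two
    components of the new condition.\<close>
  show ?thesis
    unfolding M using s 1[of "- 1 - k"] 2[of "1 - k"]
    by (auto simp: vec_eq_iff forall_2 normal_sigma_nth[OF R] gp'_def gm'_def trace_flip_def algebra_simps)
qed

text \<open>Both parts of the operator change sign: the gradient by
  \<open>weak_sigma_grad_shell_flip\<close>, the mass term because \<open>sigma3\<close>
  anticommutes with \<open>sigma2\<close>.\<close>

lemma dirac_shell_flip: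
  assumes R: "R > 0" and \<eta>: "\<eta>\<^sup>2 = 4" and T: "(\<psi>, \<phi>) \<in> dirac_shell m R \<eta> 0"
  shows "(shell_flip R \<psi>, \<lambda>x. - shell_flip R \<phi> x) \<in> dirac_shell m R \<eta> 0"
proof -
  from T obtain h gp gm where L2: "\<psi> \<in> L2 UNIV" "\<phi> \<in> L2 UNIV"
    and h: "weak_sigma_grad (Omega_plus R) \<psi> h" "weak_sigma_grad (Omega_minus R) \<psi> h"
    and tr: "dirichlet_trace (Omega_plus R) R \<psi> gp" "dirichlet_trace (Omega_minus R) R \<psi> gm"
    and bc: "\<And>k. (- \<i>) *s normal_sigma R (\<lambda>j. gp j - gm j) k =
      (1 / 2) *\<^sub>R ((\<eta> *\<^sub>R sigma0 + 0 *\<^sub>R sigma3) *v (gp k + gm k))"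
    and ae: "AE x in lborel. \<phi> x = (- \<i>) *s h x + (m *\<^sub>R sigma3) *v \<psi> x"
    unfolding dirac_shell_def shell_domain_def by blast
  note h' = weak_sigma_grad_shell_flip[OF h]
  have "shell_flip R \<psi> \<in> shell_domain R \<eta> 0"
    unfolding shell_domain_def H_sigma_def
    using L2_shell_flip[OF L2(1)] h' dirichlet_trace_shell_flip(1)[OF tr(1)]
      dirichlet_trace_shell_flip(2)[OF tr(2)] boundary_condition_flip[OF R \<eta> bc] by blast
  moreover have "(\<lambda>x. - shell_flip R \<phi> x) \<in> L2 UNIV"
    using L2_shell_flip[OF L2(2)] by (simp add: L2_def L2_sqnorm_def set_borel_measurable_def)
  moreover have "AE x in lborel. - shell_flip R \<phi> x =
      (- \<i>) *s (- shell_flip R h x) + (m *\<^sub>R sigma3) *v shell_flip R \<psi> x"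
    using AE_reflect[OF ae]
    by eventually_elim (simp add: shell_flip_def flip_def vec_eq_iff forall_2 ring_distribs scaleR_add_right)
  ultimately show ?thesis
    unfolding dirac_shell_def using h' by blast
qed

section \<open>Symmetry of the spectrum\<close>

text \<open>From here on only the anticommutation of the graph with the norm-preserving linear
  involution \<open>shell_flip R\<close> matters.\<close>

locale spectral_reflection =
  fixes T :: "((real^2 \<Rightarrow> complex^2) \<times> (real^2 \<Rightarrow> complex^2)) set" and R :: real
  assumes anticommute: "(\<psi>, \<phi>) \<in> T \<Longrightarrow> (shell_flip R \<psi>, \<lambda>x. - shell_flip R \<phi> x) \<in> T"
begin

lemma shell_flip_lincomb:
  "shell_flip R (\<lambda>x. z *s f x + g x) = (\<lambda>x. z *s shell_flip R f x + shell_flip R g x)"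
  "shell_flip R (\<lambda>x. z *s f x) = (\<lambda>x. z *s shell_flip R f x)"
  by (simp_all add: fun_eq_iff shell_flip_def flip_def vec_eq_iff forall_2 algebra_simps)

lemma AE_shell_flip:
  assumes "AE x in lborel. f x = 0"
  shows "AE x in lborel. shell_flip R f x = 0"
  using AE_reflect[OF assms] by eventually_elim (simp add: shell_flip_def flip_def)

lemma eigenspace_flip: "\<psi> \<in> eigenspace T z \<Longrightarrow> shell_flip R \<psi> \<in> eigenspace T (- z)"
  unfolding eigenspace_def using anticommute[of \<psi> "\<lambda>x. z *s \<psi> x"]
  by (simp add: shell_flip_lincomb vector_smult_lneg)

text \<open>In operator form: \<open>(T - z) \<psi> = g\<close> implies
  \<open>(T + z) (L \<psi>) = - L g\<close>.\<close>

lemma resolvent_flip_pair: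
  assumes "(\<psi>, \<lambda>x. z *s \<psi> x + g x) \<in> T"
  shows "(shell_flip R \<psi>, \<lambda>x. - z *s shell_flip R \<psi> x + - shell_flip R g x) \<in> T"
  using anticommute[OF assms] by (simp add: shell_flip_lincomb vector_smult_lneg)

lemma L2_uminus: "(\<lambda>x. - f x) \<in> L2 UNIV \<longleftrightarrow> f \<in> L2 UNIV"
  using borel_measurable_uminus_eq[of f borel]
  by (simp add: L2_def L2_sqnorm_def set_borel_measurable_def)

lemma resolvent_set_uminus:
  assumes "z \<in> resolvent_set T"
  shows "- z \<in> resolvent_set T"
proof -
  from assms have 1: "\<And>\<psi>. \<psi> \<in> eigenspace T z \<Longrightarrow> AE x in lborel. \<psi> x = 0"
    and 2: "\<And>g. g \<in> L2 UNIV \<Longrightarrow> \<exists>\<psi>. (\<psi>, \<lambda>x. z *s \<psi> x + g x) \<in> T"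
    and "\<exists>C::real. \<forall>g\<in>L2 UNIV. \<forall>\<psi>. (\<psi>, \<lambda>x. z *s \<psi> x + g x) \<in> T \<longrightarrow>
        L2_sqnorm UNIV \<psi> \<le> ennreal (C\<^sup>2) * L2_sqnorm UNIV g"
    by (auto simp: resolvent_set_def)
  then obtain C where 3: "\<And>g \<psi>. g \<in> L2 UNIV \<Longrightarrow> (\<psi>, \<lambda>x. z *s \<psi> x + g x) \<in> T \<Longrightarrow>
        L2_sqnorm UNIV \<psi> \<le> ennreal (C\<^sup>2) * L2_sqnorm UNIV g"
    by blast
  have "AE x in lborel. \<psi> x = 0" if "\<psi> \<in> eigenspace T (- z)" for \<psi>
    using AE_shell_flip[OF 1[OF eigenspace_flip[OF that, simplified]]] by simp
  moreover have "\<exists>\<psi>. (\<psi>, \<lambda>x. - z *s \<psi> x + g x) \<in> T" if "g \<in> L2 UNIV" for g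
  proof -
    \<comment> \<open>To solve for \<open>g\<close> at \<open>- z\<close>, solve at \<open>z\<close>
      with right-hand side \<open>- L g\<close> and apply \<open>L\<close> to the solution.\<close>
    have "(\<lambda>x. - shell_flip R g x) \<in> L2 UNIV"
      using that by (simp add: L2_uminus L2_shell_flip)
    from 2[OF this] obtain \<psi> where "(\<psi>, \<lambda>x. z *s \<psi> x + - shell_flip R g x) \<in> T" by blast
    moreover have "shell_flip R (\<lambda>x. - shell_flip R g x) = (\<lambda>x. - g x)"
      using shell_flip_lincomb(2)[of "- 1" "shell_flip R g"] by (simp add: vector_smult_lneg)
    ultimately have "(shell_flip R \<psi>, \<lambda>x. - z *s shell_flip R \<psi> x + g x) \<in> T"
      using resolvent_flip_pair by fastforce
    then show ?thesis by blast
  qed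
  moreover have "L2_sqnorm UNIV \<psi> \<le> ennreal (C\<^sup>2) * L2_sqnorm UNIV g"
    if "g \<in> L2 UNIV" "(\<psi>, \<lambda>x. - z *s \<psi> x + g x) \<in> T" for g \<psi>
  proof -
    \<comment> \<open>The same constant \<open>C\<close> serves at \<open>- z\<close>, because
      \<open>L\<close> preserves the norm.\<close>
    have "L2_sqnorm UNIV (shell_flip R \<psi>) \<le> ennreal (C\<^sup>2) * L2_sqnorm UNIV (\<lambda>x. - shell_flip R g x)"
      using resolvent_flip_pair[OF that(2)] that(1) by (intro 3) (simp_all add: L2_uminus L2_shell_flip)
    moreover have "L2_sqnorm UNIV (\<lambda>x. - shell_flip R g x) = L2_sqnorm UNIV (shell_flip R g)"
      by (simp add: L2_sqnorm_def)
    ultimately show ?thesis by simp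
  qed
  ultimately show ?thesis
    unfolding resolvent_set_def by blast
qed

lemma spectrum_uminus: "- z \<in> spectrum T \<longleftrightarrow> z \<in> spectrum T"
  using resolvent_set_uminus[of z] resolvent_set_uminus[of "- z"] by (auto simp: spectrum_def)

lemma discrete_spectrum_uminus:
  assumes "z \<in> discrete_spectrum T"
  shows "- z \<in> discrete_spectrum T"
proof -
  from assms obtain \<psi> where \<psi>: "\<psi> \<in> eigenspace T z" "\<not> (AE x in lborel. \<psi> x = 0)"
    by (auto simp: discrete_spectrum_def is_eigenvalue_def)
  \<comment> \<open>If \<open>L \<psi>\<close> vanished almost everywhere, so would its image under
    \<open>L\<close>, which is \<open>\<psi>\<close>.\<close>
  have "\<not> (AE x in lborel. shell_flip R \<psi> x = 0)"
    using \<psi>(2) AE_shell_flip[of "shell_flip R \<psi>"] by auto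
  then have "is_eigenvalue T (- z)"
    using eigenspace_flip[OF \<psi>(1)] by (auto simp: is_eigenvalue_def)
  moreover have "- z isolated_in spectrum T"
  proof -
    obtain e where e: "z \<in> spectrum T" "e > 0" "\<And>y. y \<in> spectrum T \<Longrightarrow> dist z y < e \<Longrightarrow> y = z"
      using assms by (auto simp: discrete_spectrum_def isolated_in_dist_Ex_iff)
    \<comment> \<open>Negation is an isometry preserving the spectrum, so the isolating radius
      \<open>e\<close> of \<open>z\<close> also isolates \<open>- z\<close>.\<close>
    have "y = - z" if "y \<in> spectrum T" "dist (- z) y < e" for y
    proof -
      have "- y = z"
        by (rule e(3)) (use that in \<open>simp_all add: spectrum_uminus dist_norm norm_minus_commute add.commute\<close>)
      then show ?thesis by auto
    qed
    then show ?thesis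
      using e spectrum_uminus by (auto simp: isolated_in_dist_Ex_iff)
  qed
  moreover have "finite_multiplicity T (- z)"
  proof -
    obtain B where B: "finite B" "B \<subseteq> eigenspace T z"
      "\<And>\<psi>. \<psi> \<in> eigenspace T z \<Longrightarrow> \<exists>c. AE x in lborel. \<psi> x = (\<Sum>b\<in>B. c b *s b x)"
      using assms unfolding discrete_spectrum_def finite_multiplicity_def by blast
    have inj: "inj_on (shell_flip R) B"
      by (metis inj_onI shell_flip_shell_flip)
    have "\<exists>c. AE x in lborel. \<psi> x = (\<Sum>b\<in>shell_flip R ` B. c b *s b x)"
      if \<psi>: "\<psi> \<in> eigenspace T (- z)" for \<psi>
    proof -
      obtain c where c: "AE x in lborel. shell_flip R \<psi> x = (\<Sum>b\<in>B. c b *s b x)"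
        using B(3)[OF eigenspace_flip[OF \<psi>, simplified]] by blast
      \<comment> \<open>\<open>L\<close> is complex linear, so the coefficients pass through without
        conjugation.\<close>
      have sum: "shell_flip R (\<lambda>x. \<Sum>b\<in>B. c b *s b x) x = (\<Sum>b\<in>B. c b *s shell_flip R b x)" for x
        by (simp add: shell_flip_def flip_def vec_eq_iff forall_2 sum_distrib_left scaleR_sum_right algebra_simps)
      have "AE x in lborel. shell_flip R (shell_flip R \<psi>) x = shell_flip R (\<lambda>x. \<Sum>b\<in>B. c b *s b x) x"
        using AE_reflect[OF c] by eventually_elim (rule shell_flip_cong)
      \<comment> \<open>The coefficient of \<open>b\<close> in the image family is that of its
        preimage, which is \<open>shell_flip R b\<close> by involutivity.\<close>
      then have "AE x in lborel. \<psi> x = (\<Sum>b\<in>shell_flip R ` B. c (shell_flip R b) *s b x)"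
        by (simp add: sum sum.reindex[OF inj])
      then show ?thesis by (rule exI[of _ "\<lambda>b. c (shell_flip R b)"])
    qed
    moreover have "shell_flip R ` B \<subseteq> eigenspace T (- z)"
      using B(2) eigenspace_flip by auto
    ultimately show ?thesis
      unfolding finite_multiplicity_def using B(1) by blast
  qed
  ultimately show ?thesis
    by (simp add: discrete_spectrum_def)
qed

end

theorem corollary1p3:
  fixes m R \<eta> \<tau> :: real
  assumes "m > 0" and "R > 0" and "\<eta>\<^sup>2 - \<tau>\<^sup>2 = 4" and "\<tau> = 0"
  shows "\<forall>z::complex. z \<in> discrete_spectrum (dirac_shell m R \<eta> \<tau>) \<longleftrightarrow>
                      - z \<in> discrete_spectrum (dirac_shell m R \<eta> \<tau>)"
proof -
  interpret spectral_reflection "dirac_shell m R \<eta> \<tau>" R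
    \<comment> \<open>With \<open>\<tau> = 0\<close> the hypothesis on the coupling becomes
      \<open>\<eta>\<^sup>2 = 4\<close>.\<close>
    by unfold_locales (use assms dirac_shell_flip[of R \<eta>] in auto)
  show ?thesis
    using discrete_spectrum_uminus by fastforce
qed

end
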